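(* Let $S$ be a locally compact semitopological polycyclic monoid. Then $S$ is either discrete or compact. More precisely, there is a unique cardinal $\lambda\ge 2$ such that $S$ is topologically isomorphic either to $\mathcal P^d_\lambda$ or to $\mathcal P^c_\lambda$.
   Context: A semigroup $S$ is inverse if for every $a\in S$ there is a unique $a^{-1}\in S$ with $aa^{-1}a=a$ and $a^{-1}aa^{-1}=a^{-1}$. An inverse monoid is an inverse semigroup with unit $1$. An inverse monoid $S$ is generated by a subset $\Lambda\subset S$ if $S$ is the smallest subsemigroup of $S$ containing $\Lambda\cup\Lambda^{-1}$. A polycyclic monoid is an inverse monoid $S$ with zero $0\neq 1$ that is generated by a subset $\Lambda\subset S$ such that $xx^{-1}=1$ for all $x\in\Lambda$ and $xy^{-1}=0$ for any distinct $x,y\in\Lambda$. (Necessarily $|\Lambda|\ge 2$.) For a cardinal $\lambda\ge 2$ (identified with the set of ordinals of smaller cardinality), the $\lambda$-polycyclic monoid $\mathcal P_\lambda$ is defined as follows. Let $\mathcal M_{\lambda^\pm}$ be the monoid of all words in the alphabet $\{x,x^{-1}:x\in\lambda\}$ under concatenation, with the empty word as unit $1$, and let $\mathcal M^0_{\lambda^\pm}=\mathcal M_{\lambda^\pm}\cup\{0\}$ be this monoid with an external zero $0$ attached. Then $\mathcal P_\lambda$ is the quotient of $\mathcal M^0_{\lambda^\pm}$ by the smallest congruence containing the pairs $(xx^{-1},1)$ and $(xy^{-1},0)$ for all distinct $x,y\in\lambda$. A semitopological semigroup is a semigroup $S$ endowed with a Hausdorff topology making the operation $S\times S\to S$, $(x,y)\mapsto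 xy$, separately continuous. A locally compact semitopological polycyclic monoid is a polycyclic monoid that is a semitopological semigroup whose topology is locally compact. $\mathcal P^d_\lambda$ denotes $\mathcal P_\lambda$ with the discrete topology. $\mathcal P^c_\lambda$ denotes $\mathcal P_\lambda$ with the compact topology $\tau=\{U\subset\mathcal P_\lambda: 0\in U\Rightarrow \mathcal P_\lambda\setminus U\text{ is finite}\}$, i.e. the topology of the one-point compactification of the discrete space $\mathcal P_\lambda\setminus\{0\}$. Topologically isomorphic means that there is a semigroup isomorphism that is also a homeomorphism. *)

theory Defs
  imports "HOL-Analysis.Analysis" "HOL-Algebra.Coset"
begin

unbundle cardinal_syntax

section \<open>Polycyclic monoids\<close>

(* The semigroup inverse. HOL-Algebra's m_inv is the inverse of a unit, which is a different notion. *)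
definition is_sg_inverse :: "('a, 'm) monoid_scheme \<Rightarrow> 'a \<Rightarrow> 'a \<Rightarrow> bool" where
  "is_sg_inverse S a b \<longleftrightarrow>
     b \<in> carrier S \<and> a \<otimes>\<^bsub>S\<^esub> b \<otimes>\<^bsub>S\<^esub> a = a \<and> b \<otimes>\<^bsub>S\<^esub> a \<otimes>\<^bsub>S\<^esub> b = b"

definition sg_inverse :: "('a, 'm) monoid_scheme \<Rightarrow> 'a \<Rightarrow> 'a" where
  "sg_inverse S a = (THE b. is_sg_inverse S a b)"

definition inverse_monoid :: "('a, 'm) monoid_scheme \<Rightarrow> bool" where
  "inverse_monoid S \<longleftrightarrow> monoid S \<and> (\<forall>a\<in>carrier S. \<exists>!b. is_sg_inverse S a b)"

definition subsemigroup :: "'a set \<Rightarrow> ('a, 'm) monoid_scheme \<Rightarrow> bool" where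
  "subsemigroup H S \<longleftrightarrow> H \<subseteq> carrier S \<and> (\<forall>a\<in>H. \<forall>b\<in>H. a \<otimes>\<^bsub>S\<^esub> b \<in> H)"

definition inverse_generated_by :: "('a, 'm) monoid_scheme \<Rightarrow> 'a set \<Rightarrow> bool" where
  "inverse_generated_by S \<Lambda> \<longleftrightarrow>
     carrier S = \<Inter> {H. subsemigroup H S \<and> \<Lambda> \<union> sg_inverse S ` \<Lambda> \<subseteq> H}"

definition is_zero :: "('a, 'm) monoid_scheme \<Rightarrow> 'a \<Rightarrow> bool" where
  "is_zero S z \<longleftrightarrow>
     z \<in> carrier S \<and> (\<forall>a\<in>carrier S. a \<otimes>\<^bsub>S\<^esub> z = z \<and> z \<otimes>\<^bsub>S\<^esub> a = z)"

definition polycyclic_monoid :: "('a, 'm) monoid_scheme \<Rightarrow> bool" where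
  "polycyclic_monoid S \<longleftrightarrow>
     inverse_monoid S \<and>
     (\<exists>z \<Lambda>. is_zero S z \<and> z \<noteq> \<one>\<^bsub>S\<^esub> \<and>
        \<Lambda> \<subseteq> carrier S \<and> inverse_generated_by S \<Lambda> \<and>
        (\<forall>x\<in>\<Lambda>. x \<otimes>\<^bsub>S\<^esub> sg_inverse S x = \<one>\<^bsub>S\<^esub>) \<and>
        (\<forall>x\<in>\<Lambda>. \<forall>y\<in>\<Lambda>. x \<noteq> y \<longrightarrow> x \<otimes>\<^bsub>S\<^esub> sg_inverse S y = z))"

definition lc_semitopological_polycyclic_monoid ::
    "('a, 'm) monoid_scheme \<Rightarrow> 'a topology \<Rightarrow> bool" where
  "lc_semitopological_polycyclic_monoid S T \<longleftrightarrow>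
     polycyclic_monoid S \<and> topspace T = carrier S \<and> Hausdorff_space T \<and>
     (\<forall>a\<in>carrier S. continuous_map T T (\<lambda>x. a \<otimes>\<^bsub>S\<^esub> x)) \<and>
     (\<forall>a\<in>carrier S. continuous_map T T (\<lambda>x. x \<otimes>\<^bsub>S\<^esub> a)) \<and>
     locally_compact_space T"

section \<open>Quotients of monoids by congruences\<close>

definition monoid_congruence :: "('a, 'm) monoid_scheme \<Rightarrow> ('a \<times> 'a) set \<Rightarrow> bool" where
  "monoid_congruence M R \<longleftrightarrow>
     equiv (carrier M) R \<and>
     (\<forall>(a, b)\<in>R. \<forall>(c, d)\<in>R. (a \<otimes>\<^bsub>M\<^esub> c, b \<otimes>\<^bsub>M\<^esub> d) \<in> R)"

definition congruence_generated_by ::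
    "('a, 'm) monoid_scheme \<Rightarrow> ('a \<times> 'a) set \<Rightarrow> ('a \<times> 'a) set" where
  "congruence_generated_by M E = \<Inter> {R. monoid_congruence M R \<and> E \<subseteq> R}"

definition quotient_monoid :: "('a, 'm) monoid_scheme \<Rightarrow> ('a \<times> 'a) set \<Rightarrow> 'a set monoid" where
  "quotient_monoid M R =
     \<lparr>carrier = carrier M // R, mult = (\<lambda>A B. R `` (A <#>\<^bsub>M\<^esub> B)), one = R `` {\<one>\<^bsub>M\<^esub>}\<rparr>"

lemma monoid_congruence_generated:
  assumes M: "monoid M" and E: "E \<subseteq> carrier M \<times> carrier M"
  shows "monoid_congruence M (congruence_generated_by M E)"
proof -
  let ?F = "{R. monoid_congruence M R \<and> E \<subseteq> R}"
  have full: "carrier M \<times> carrier M \<in> ?F"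
    using E monoid.m_closed[OF M] by (auto simp: monoid_congruence_def equiv_def refl_on_def sym_def trans_def)
  have "equiv (carrier M) (\<Inter> ?F)"
  proof (rule equivI)
    show "\<Inter> ?F \<subseteq> carrier M \<times> carrier M" using full by blast
    show "refl_on (carrier M) (\<Inter> ?F)"
      by (auto simp: monoid_congruence_def equiv_def refl_on_def)
    show "sym (\<Inter> ?F)"
      by (rule symI) (auto simp: monoid_congruence_def equiv_def dest: symD)
    show "trans (\<Inter> ?F)"
      by (rule transI) (auto simp: monoid_congruence_def equiv_def dest: transD)
  qed
  moreover have "(a \<otimes>\<^bsub>M\<^esub> c, b \<otimes>\<^bsub>M\<^esub> d) \<in> \<Inter> ?F"
    if ab: "(a, b) \<in> \<Inter> ?F" and cd: "(c, d) \<in> \<Inter> ?F" for a b c d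
  proof (rule InterI)
    fix R assume "R \<in> ?F"
    moreover from this have "(a, b) \<in> R" "(c, d) \<in> R" using ab cd by blast+
    ultimately show "(a \<otimes>\<^bsub>M\<^esub> c, b \<otimes>\<^bsub>M\<^esub> d) \<in> R" unfolding monoid_congruence_def by blast
  qed
  ultimately show ?thesis
    unfolding congruence_generated_by_def monoid_congruence_def[of M "\<Inter> ?F"] by blast
qed

lemma quotient_monoid_mult:
  assumes R: "monoid_congruence M R" and ab: "a \<in> carrier M" "b \<in> carrier M"
  shows "R `` {a} \<otimes>\<^bsub>quotient_monoid M R\<^esub> R `` {b} = R `` {a \<otimes>\<^bsub>M\<^esub> b}"
proof -
  have eq: "equiv (carrier M) R" and
    comp: "\<And>a b c d. (a, b) \<in> R \<Longrightarrow> (c, d) \<in> R \<Longrightarrow> (a \<otimes>\<^bsub>M\<^esub> c, b \<otimes>\<^bsub>M\<^esub> d) \<in> R"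
    using R by (auto simp: monoid_congruence_def)
  have refl: "(a, a) \<in> R" "(b, b) \<in> R" and trans: "trans R"
    using eq ab by (auto simp: equiv_def refl_on_def)
  have "R `` (R `` {a} <#>\<^bsub>M\<^esub> R `` {b}) = R `` {a \<otimes>\<^bsub>M\<^esub> b}"
  proof (intro equalityI subsetI)
    fix x assume "x \<in> R `` (R `` {a} <#>\<^bsub>M\<^esub> R `` {b})"
    then obtain c d where "(a, c) \<in> R" "(b, d) \<in> R" "(c \<otimes>\<^bsub>M\<^esub> d, x) \<in> R"
      unfolding set_mult_def by blast
    then show "x \<in> R `` {a \<otimes>\<^bsub>M\<^esub> b}" using comp transD[OF trans] by blast
  next
    fix x assume "x \<in> R `` {a \<otimes>\<^bsub>M\<^esub> b}"
    then show "x \<in> R `` (R `` {a} <#>\<^bsub>M\<^esub> R `` {b})"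
      using refl unfolding set_mult_def by blast
  qed
  then show ?thesis by (simp add: quotient_monoid_def)
qed

section \<open>The polycyclic monoid over an alphabet\<close>

datatype 'x letter = Pos 'x | Neg 'x

definition letters :: "'x set \<Rightarrow> 'x letter set" where
  "letters X = Pos ` X \<union> Neg ` X"

(* None is the external zero. *)
definition words_with_zero :: "'x set \<Rightarrow> 'x letter list option monoid" where
  "words_with_zero X =
     \<lparr>carrier = insert None (Some ` lists (letters X)),
      mult = (\<lambda>u v. case (u, v) of (Some a, Some b) \<Rightarrow> Some (a @ b) | _ \<Rightarrow> None),
      one = Some []\<rparr>"

definition polycyclic_relators :: "'x set \<Rightarrow> ('x letter list option \<times> 'x letter list option) set" where
  "polycyclic_relators X =
     {(Some [Pos x, Neg x], Some []) | x. x \<in> X} \<union>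
     {(Some [Pos x, Neg y], None) | x y. x \<in> X \<and> y \<in> X \<and> x \<noteq> y}"

definition polycyclic_congruence ::
    "'x set \<Rightarrow> ('x letter list option \<times> 'x letter list option) set" where
  "polycyclic_congruence X = congruence_generated_by (words_with_zero X) (polycyclic_relators X)"

(* A cardinal is a cardinal order r in the sense of HOL's cardinal library; its underlying
   set, well-ordered by r, plays the role of the set of ordinals of smaller cardinality. *)
definition polycyclic :: "'x rel \<Rightarrow> 'x letter list option set monoid" where
  "polycyclic r = quotient_monoid (words_with_zero (Field r)) (polycyclic_congruence (Field r))"

definition polycyclic_zero :: "'x rel \<Rightarrow> 'x letter list option set" where
  "polycyclic_zero r = polycyclic_congruence (Field r) `` {None}"

definition polycyclic_discrete_topology :: "'x rel \<Rightarrow> 'x letter list option set topology" where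
  "polycyclic_discrete_topology r = discrete_topology (carrier (polycyclic r))"

definition polycyclic_compact_topology :: "'x rel \<Rightarrow> 'x letter list option set topology" where
  "polycyclic_compact_topology r =
     topology (\<lambda>U. U \<subseteq> carrier (polycyclic r) \<and>
       (polycyclic_zero r \<in> U \<longrightarrow> finite (carrier (polycyclic r) - U)))"

lemma monoid_words_with_zero: "monoid (words_with_zero X)"
  by (rule monoidI) (auto simp: words_with_zero_def image_iff split: option.splits)

lemma monoid_congruence_polycyclic:
  "monoid_congruence (words_with_zero X) (polycyclic_congruence X)"
  unfolding polycyclic_congruence_def
  by (rule monoid_congruence_generated[OF monoid_words_with_zero])
    (auto simp: polycyclic_relators_def words_with_zero_def letters_def)

lemma openin_polycyclic_compact_topology:
  "openin (polycyclic_compact_topology r) U \<longleftrightarrow>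
     U \<subseteq> carrier (polycyclic r) \<and>
     (polycyclic_zero r \<in> U \<longrightarrow> finite (carrier (polycyclic r) - U))"
proof -
  let ?P = "carrier (polycyclic r)" and ?z = "polycyclic_zero r"
  have "istopology (\<lambda>U. U \<subseteq> ?P \<and> (?z \<in> U \<longrightarrow> finite (?P - U)))"
    unfolding istopology_def
  proof (intro conjI allI impI)
    fix A B assume "A \<subseteq> ?P \<and> (?z \<in> A \<longrightarrow> finite (?P - A))"
      and "B \<subseteq> ?P \<and> (?z \<in> B \<longrightarrow> finite (?P - B))"
    then show "A \<inter> B \<subseteq> ?P" and "?z \<in> A \<inter> B \<Longrightarrow> finite (?P - A \<inter> B)"
      by (auto simp: Diff_Int)
  next
    fix K assume K: "\<forall>U\<in>K. U \<subseteq> ?P \<and> (?z \<in> U \<longrightarrow> finite (?P - U))"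
    then show "\<Union> K \<subseteq> ?P" by blast
    assume "?z \<in> \<Union> K"
    then obtain U where "U \<in> K" "finite (?P - U)" using K by blast
    then show "finite (?P - \<Union> K)" by (auto elim: rev_finite_subset)
  qed
  then show ?thesis
    by (simp add: polycyclic_compact_topology_def)
qed

section \<open>Topological isomorphism\<close>

definition topologically_isomorphic ::
    "('a, 'm) monoid_scheme \<Rightarrow> 'a topology \<Rightarrow> ('b, 'n) monoid_scheme \<Rightarrow> 'b topology \<Rightarrow> bool" where
  "topologically_isomorphic S T S' T' \<longleftrightarrow>
     (\<exists>f. f \<in> iso S S' \<and> homeomorphic_map T T' f)"

definition cardinal_ge_2 :: "'x rel \<Rightarrow> bool" where
  "cardinal_ge_2 r \<longleftrightarrow> Card_order r \<and> ctwo \<le>o r"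

end

theory Submission
  imports Defs
begin

text \<open>
  Every element of a polycyclic monoid is zero or a product \<open>u\<inverse> v\<close> of an inverted and a plain word in
  the generators. As \<open>0 \<noteq> 1\<close>, these normal forms are unique: a generator on the left of a nonempty \<open>u\<inverse>\<close>
  either strips a letter or yields zero, and so does an inverse on the right of a nonempty \<open>v\<close>. If one
  of the words is empty, some other generator tells the forms apart. Uniqueness makes every
  polycyclic monoid isomorphic to the one presented by its generators. It also shows that the
  generators are exactly the indecomposable elements of the monoid of right units, which is free on
  them; hence the cardinal is an isomorphism invariant.

  Topologically, \<open>1\<close> is isolated: for two generators \<open>x \<noteq> y\<close> it is the only \<open>s\<close> such that \<open>x s\<close>, \<open>y s\<close>,
  \<open>s x\<inverse>\<close> and \<open>s y\<inverse>\<close> are all nonzero. Translations by generators pull this back to every nonzero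
  element, because their nonzero fibres are finite. So only zero can fail to be isolated, and if it
  does, it has a compact open neighbourhood \<open>K\<close>, which is infinite. A compact set all of whose
  points are isolated is finite; hence each of the injective translations \<open>s \<mapsto> s x\<close> and \<open>s \<mapsto> x\<inverse> s\<close>
  carries only finitely many points across the boundary of \<open>K\<close>. On pairs of words \<open>(u, v)\<close> these
  translations add one letter to \<open>v\<close> or to \<open>u\<close>, and the set of such pairs has only one end, as a
  quarter-plane does: a subset with finite boundary in each of these directions is finite or
  cofinite. So \<open>K\<close> is cofinite, and the topology is that of the one-point compactification.
\<close>

section \<open>Sets of pairs of words with finite boundary\<close>

lemma eventually_constant:
  fixes f :: "nat \<Rightarrow> 'b"
  assumes "\<forall>\<^sub>F n in sequentially. f (Suc n) = f n"
  shows "\<exists>c. \<forall>\<^sub>F n in sequentially. f n = c"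
proof -
  obtain N where N: "\<And>n. n \<ge> N \<Longrightarrow> f (Suc n) = f n"
    using assms by (auto simp: eventually_sequentially)
  have "f n = f N" if "n \<ge> N" for n
    using that by (induction rule: dec_induct) (auto simp: N)
  then show ?thesis by (auto simp: eventually_sequentially)
qed

lemma eventually_not_in_finite:
  fixes f :: "nat \<Rightarrow> 'b"
  assumes "finite B" "inj f"
  shows "\<forall>\<^sub>F n in sequentially. f n \<notin> B"
proof -
  have "finite (f -` B)" using assms by (rule finite_vimageI)
  then have "\<forall>\<^sub>F n in cofinite. f n \<notin> B"
    by (simp add: eventually_cofinite vimage_def)
  then show ?thesis by (simp add: cofinite_eq_sequentially)
qed

lemma inj_replicate_append: "inj (\<lambda>n. replicate n x @ v)"
  by (rule injI, drule arg_cong[of _ _ length]) simp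

text \<open>
  Fix a letter \<open>x\<close>. Along a ray \<open>(u, x\<^sup>n v)\<close> membership in the set is eventually constant, and changing
  \<open>u\<close> by one letter does not change this limit, as two such rays differ in finitely many places only.
  The same holds for rays in the other direction, and the two kinds of rays meet in the
  quarter-planes \<open>(x\<^sup>m u, x\<^sup>n v)\<close>. So all rays have the same limit, and a pair that disagrees with it
  lies below a boundary point of its own ray.
\<close>
lemma finite_or_cofinite_if_finite_boundary:
  fixes A :: "'x list \<Rightarrow> 'x list \<Rightarrow> bool"
  assumes x: "x \<in> X"
    and L: "\<And>y. y \<in> X \<Longrightarrow> finite {(u, v) \<in> lists X \<times> lists X. A (y # u) v \<noteq> A u v}"
    and R: "\<And>y. y \<in> X \<Longrightarrow> finite {(u, v) \<in> lists X \<times> lists X. A u (y # v) \<noteq> A u v}"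
  shows "finite {(u, v) \<in> lists X \<times> lists X. A u v} \<or>
         finite {(u, v) \<in> lists X \<times> lists X. \<not> A u v}"
proof -
  let ?W = "lists X"
  define \<rho> where "\<rho> n v = replicate n x @ v" for n v
  have \<rho>_in: "\<rho> n v \<in> ?W" if "v \<in> ?W" for n v
    using that x by (auto simp: \<rho>_def in_lists_conv_set)
  have \<rho>_Suc: "\<rho> (Suc n) v = x # \<rho> n v" for n v by (simp add: \<rho>_def)
  have inj\<rho>: "inj (\<lambda>n. \<rho> n v)" for v
    unfolding \<rho>_def by (rule inj_replicate_append)
  have inj1: "inj (\<lambda>n. (u, \<rho> n v))" and inj2: "inj (\<lambda>n. (\<rho> n u, v))" for u v
    using inj\<rho> by (auto simp: inj_on_def)
  define \<alpha> where "\<alpha> u v c \<longleftrightarrow> (\<forall>\<^sub>F n in sequentially. A u (\<rho> n v) = c)" for u v c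
  define \<beta> where "\<beta> u v c \<longleftrightarrow> (\<forall>\<^sub>F n in sequentially. A (\<rho> n u) v = c)" for u v c
  have \<alpha>_ex: "\<exists>c. \<alpha> u v c" if "u \<in> ?W" "v \<in> ?W" for u v
    unfolding \<alpha>_def
    by (rule eventually_constant,
        rule eventually_mono[OF eventually_not_in_finite[OF R[OF x] inj1, of u v]])
       (use that \<rho>_in in \<open>auto simp: \<rho>_Suc\<close>)
  have \<alpha>_step: "\<alpha> (y # u) v c \<longleftrightarrow> \<alpha> u v c" if "y \<in> X" "u \<in> ?W" "v \<in> ?W" for y u v c
  proof -
    have "\<forall>\<^sub>F n in sequentially. A (y # u) (\<rho> n v) = A u (\<rho> n v)"
      by (rule eventually_mono[OF eventually_not_in_finite[OF L[OF that(1)] inj1, of u v]])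
        (use that \<rho>_in in auto)
    then show ?thesis unfolding \<alpha>_def by (rule eventually_subst[OF eventually_mono]) simp
  qed
  have \<beta>_step: "\<beta> u (y # v) c \<longleftrightarrow> \<beta> u v c" if "y \<in> X" "u \<in> ?W" "v \<in> ?W" for y u v c
  proof -
    have "\<forall>\<^sub>F n in sequentially. A (\<rho> n u) (y # v) = A (\<rho> n u) v"
      by (rule eventually_mono[OF eventually_not_in_finite[OF R[OF that(1)] inj2, of u v]])
        (use that \<rho>_in in auto)
    then show ?thesis unfolding \<beta>_def by (rule eventually_subst[OF eventually_mono]) simp
  qed
  have \<alpha>_Nil: "\<alpha> u v c \<longleftrightarrow> \<alpha> [] v c" if "u \<in> ?W" "v \<in> ?W" for u v c
    using that by (induction u) (auto simp: \<alpha>_step)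
  have \<beta>_Nil: "\<beta> u v c \<longleftrightarrow> \<beta> u [] c" if "u \<in> ?W" "v \<in> ?W" for u v c
    using that(2,1) by (induction v) (auto simp: \<beta>_step)
  have \<alpha>_\<beta>: "\<beta> u v c" if u: "u \<in> ?W" and v: "v \<in> ?W" and c: "\<alpha> u v c" for u v c
  proof -
    have "\<forall>\<^sub>F m in sequentially.
        \<rho> m u \<notin> fst ` {(u, v) \<in> ?W \<times> ?W. A u (x # v) \<noteq> A u v}"
      by (rule eventually_not_in_finite[OF finite_imageI[OF R[OF x]] inj\<rho>])
    then show ?thesis unfolding \<beta>_def
    proof eventually_elim
      case (elim m)
      have step: "A (\<rho> m u) (\<rho> (Suc n) v) = A (\<rho> m u) (\<rho> n v)" for n
      proof (rule ccontr)
        assume "\<not> ?thesis"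
        then have "(\<rho> m u, \<rho> n v) \<in> {(u, v) \<in> ?W \<times> ?W. A u (x # v) \<noteq> A u v}"
          using \<rho>_in[OF u] \<rho>_in[OF v] by (simp add: \<rho>_Suc)
        then have "\<rho> m u \<in> fst ` {(u, v) \<in> ?W \<times> ?W. A u (x # v) \<noteq> A u v}"
          by (metis (no_types, lifting) fst_conv imageI)
        then show False using elim by contradiction
      qed
      have const: "A (\<rho> m u) (\<rho> n v) = A (\<rho> m u) v" for n
      proof (induction n)
        case 0
        show ?case by (simp add: \<rho>_def)
      next
        case (Suc n)
        then show ?case by (simp only: step)
      qed
      have "\<alpha> (\<rho> m u) v c"
        using c by (simp only: \<alpha>_Nil[OF u v] \<alpha>_Nil[OF \<rho>_in[OF u] v])
      then show ?case by (simp add: \<alpha>_def const)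
    qed
  qed
  have \<beta>_unique: "c = c'" if "\<beta> u v c" "\<beta> u v c'" for u v c c'
  proof -
    have "\<forall>\<^sub>F n in sequentially. c = c'"
      using that unfolding \<beta>_def by eventually_elim simp
    then show ?thesis by simp
  qed
  obtain c where c: "\<alpha> [] [] c" using \<alpha>_ex[of "[]" "[]"] by auto
  have limit: "\<alpha> u v c" if u: "u \<in> ?W" and v: "v \<in> ?W" for u v
  proof -
    obtain c' where c': "\<alpha> [] v c'" using \<alpha>_ex[of "[]" v] v by auto
    have "\<beta> [] v c'" using \<alpha>_\<beta>[OF _ v c'] by simp
    moreover have "\<beta> [] v c" using \<alpha>_\<beta>[OF _ _ c] \<beta>_Nil[of "[]" v c] v by simp
    ultimately have "c = c'" by (rule \<beta>_unique[rotated])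
    then show ?thesis using c' by (simp only: \<alpha>_Nil[OF u v])
  qed
  let ?B = "{(u, v) \<in> ?W \<times> ?W. A u (x # v) \<noteq> A u v}"
  have "{(u, v) \<in> ?W \<times> ?W. A u v \<noteq> c} \<subseteq>
      (\<Union>(u, w) \<in> ?B. {u} \<times> (\<lambda>n. drop n w) ` {..length w})"
  proof
    fix s assume "s \<in> {(u, v) \<in> ?W \<times> ?W. A u v \<noteq> c}"
    then obtain u v where s: "s = (u, v)" and uv: "u \<in> ?W" "v \<in> ?W" "A u v \<noteq> c" by blast
    obtain m where m: "A u (\<rho> m v) = c"
      using limit[OF uv(1,2)] by (auto simp: \<alpha>_def eventually_sequentially)
    have "\<exists>n. A u (\<rho> n v) \<noteq> c \<and> A u (\<rho> (Suc n) v) = c"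
    proof (rule ccontr)
      assume no: "\<not> ?thesis"
      have "A u (\<rho> n v) \<noteq> c" for n
      proof (induction n)
        case 0
        show ?case using uv by (simp add: \<rho>_def)
      next
        case (Suc n)
        then show ?case using no by blast
      qed
      then show False using m by blast
    qed
    then obtain n where n: "A u (\<rho> n v) \<noteq> c" "A u (\<rho> (Suc n) v) = c" by blast
    then have "(u, \<rho> n v) \<in> ?B" using uv(1) \<rho>_in[OF uv(2)] by (simp add: \<rho>_Suc)
    moreover have "v = drop n (\<rho> n v)" "n \<le> length (\<rho> n v)" by (auto simp: \<rho>_def)
    ultimately show "s \<in> (\<Union>(u, w) \<in> ?B. {u} \<times> (\<lambda>n. drop n w) ` {..length w})"
      unfolding s by (intro UN_I[of "(u, \<rho> n v)"]) auto
  qed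
  moreover have "finite \<dots>" using R[OF x] by auto
  ultimately have "finite {(u, v) \<in> ?W \<times> ?W. A u v \<noteq> c}" by (rule finite_subset)
  then show ?thesis by (cases c) (simp_all add: case_prod_unfold)
qed

section \<open>Normal forms\<close>

text \<open>
  The generators are indexed by letters, and the map \<open>p\<close> need not be injective: in this way the
  locale also covers the presented monoid before it is known that no two letters, nor
  zero and one, collapse in it.
\<close>
locale polycyclic_system = monoid G for G (structure) +
  fixes X :: "'x set" and p q :: "'x \<Rightarrow> 'a" and z :: 'a
  assumes p_closed [simp, intro]: "x \<in> X \<Longrightarrow> p x \<in> carrier G"
    and q_closed [simp, intro]: "x \<in> X \<Longrightarrow> q x \<in> carrier G"
    and zero: "is_zero G z"
    and pq_same: "x \<in> X \<Longrightarrow> p x \<otimes> q x = \<one>"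
    and pq_distinct: "x \<in> X \<Longrightarrow> y \<in> X \<Longrightarrow> x \<noteq> y \<Longrightarrow> p x \<otimes> q y = z"
    and generated: "\<lbrakk>H \<subseteq> carrier G; \<one> \<in> H;
      \<And>x h. x \<in> X \<Longrightarrow> h \<in> H \<Longrightarrow> p x \<otimes> h \<in> H;
      \<And>x h. x \<in> X \<Longrightarrow> h \<in> H \<Longrightarrow> q x \<otimes> h \<in> H\<rbrakk> \<Longrightarrow> carrier G \<subseteq> H"
begin

lemma z_closed [simp, intro]: "z \<in> carrier G"
  and z_left [simp]: "a \<in> carrier G \<Longrightarrow> z \<otimes> a = z"
  and z_right [simp]: "a \<in> carrier G \<Longrightarrow> a \<otimes> z = z"
  using zero by (auto simp: is_zero_def)

text \<open>
  The head of a list is the outermost letter: the last factor of \<open>pos v\<close> and the first factor of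
  \<open>neg u\<close>. In this order, translation by a generator adds or removes the head of a list.
\<close>
primrec pos :: "'x list \<Rightarrow> 'a" where
  "pos [] = \<one>"
| "pos (x # v) = pos v \<otimes> p x"

primrec neg :: "'x list \<Rightarrow> 'a" where
  "neg [] = \<one>"
| "neg (x # u) = q x \<otimes> neg u"

definition nf :: "'x list \<Rightarrow> 'x list \<Rightarrow> 'a" where
  "nf u v = neg u \<otimes> pos v"

lemma pos_closed [simp, intro]: "v \<in> lists X \<Longrightarrow> pos v \<in> carrier G"
  by (induction v) auto

lemma neg_closed [simp, intro]: "v \<in> lists X \<Longrightarrow> neg v \<in> carrier G"
  by (induction v) auto

lemma nf_closed [simp, intro]: "u \<in> lists X \<Longrightarrow> v \<in> lists X \<Longrightarrow> nf u v \<in> carrier G"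
  by (simp add: nf_def)

lemma pos_append: "v \<in> lists X \<Longrightarrow> w \<in> lists X \<Longrightarrow> pos (v @ w) = pos w \<otimes> pos v"
  by (induction v) (auto simp: m_assoc)

lemma pos_neg: "v \<in> lists X \<Longrightarrow> pos v \<otimes> neg v = \<one>"
proof (induction v)
  case (Cons x v)
  then have "pos (x # v) \<otimes> neg (x # v) = pos v \<otimes> ((p x \<otimes> q x) \<otimes> neg v)"
    by (simp add: m_assoc)
  then show ?case using Cons by (simp add: pq_same)
qed simp

lemma nf_Nil: "v \<in> lists X \<Longrightarrow> nf [] v = pos v"
  by (simp add: nf_def)

lemma nf_Cons_left:
  "x \<in> X \<Longrightarrow> u \<in> lists X \<Longrightarrow> v \<in> lists X \<Longrightarrow> nf (x # u) v = q x \<otimes> nf u v"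
  by (simp add: nf_def m_assoc)

lemma nf_Cons_right:
  "x \<in> X \<Longrightarrow> u \<in> lists X \<Longrightarrow> v \<in> lists X \<Longrightarrow> nf u (x # v) = nf u v \<otimes> p x"
  by (simp add: nf_def m_assoc)

lemma p_nf_Nil: "x \<in> X \<Longrightarrow> v \<in> lists X \<Longrightarrow> p x \<otimes> nf [] v = nf [] (v @ [x])"
  by (simp add: nf_Nil pos_append)

lemma p_nf_Cons:
  assumes "x \<in> X" "y \<in> X" "u \<in> lists X" "v \<in> lists X"
  shows "p x \<otimes> nf (y # u) v = (if x = y then nf u v else z)"
proof -
  have "p x \<otimes> nf (y # u) v = (p x \<otimes> q y) \<otimes> nf u v"
    using assms by (simp add: nf_Cons_left m_assoc)
  then show ?thesis using assms by (simp add: pq_same pq_distinct)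
qed

lemma nf_q_Cons:
  assumes "x \<in> X" "y \<in> X" "u \<in> lists X" "v \<in> lists X"
  shows "nf u (y # v) \<otimes> q x = (if x = y then nf u v else z)"
proof -
  have "nf u (y # v) \<otimes> q x = nf u v \<otimes> (p y \<otimes> q x)"
    using assms by (simp add: nf_Cons_right m_assoc)
  then show ?thesis using assms by (simp add: pq_same pq_distinct)
qed

lemma nf_exists:
  assumes "s \<in> carrier G" "s \<noteq> z"
  obtains u v where "u \<in> lists X" "v \<in> lists X" "s = nf u v"
proof -
  let ?H = "insert z {nf u v | u v. u \<in> lists X \<and> v \<in> lists X}"
  have "carrier G \<subseteq> ?H"
  proof (rule generated)
    show "\<one> \<in> ?H" by (force simp: nf_def intro: exI[of _ "[]"])
    fix x h assume x: "x \<in> X" and h: "h \<in> ?H"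
    show "q x \<otimes> h \<in> ?H"
    proof (cases "h = z")
      case False
      then obtain u v where "u \<in> lists X" "v \<in> lists X" "h = nf u v" using h by auto
      then have "x # u \<in> lists X" "v \<in> lists X" "q x \<otimes> h = nf (x # u) v"
        using x by (auto simp: nf_Cons_left)
      then show ?thesis by blast
    qed (use x in auto)
    show "p x \<otimes> h \<in> ?H"
    proof (cases "h = z")
      case False
      then obtain u v where uv: "u \<in> lists X" "v \<in> lists X" and h: "h = nf u v" using h by auto
      show ?thesis
      proof (cases u)
        case Nil
        have "v @ [x] \<in> lists X" "p x \<otimes> h = nf [] (v @ [x])"
          using x uv h Nil by (auto simp: p_nf_Nil)
        then show ?thesis by blast
      next
        case (Cons y u')
        then show ?thesis using x uv h by (auto simp: p_nf_Cons)
      qed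
    qed (use x in auto)
  qed auto
  then show ?thesis using assms that by blast
qed

end

locale nontrivial_polycyclic_system = polycyclic_system +
  assumes z_neq_one: "z \<noteq> \<one>"
begin

lemma p_nonzero: "x \<in> X \<Longrightarrow> p x \<noteq> z"
proof
  assume x: "x \<in> X" and "p x = z"
  then have "p x \<otimes> q x = z" by simp
  then show False using x pq_same z_neq_one by simp
qed

lemma q_nonzero: "x \<in> X \<Longrightarrow> q x \<noteq> z"
proof
  assume x: "x \<in> X" and "q x = z"
  then have "p x \<otimes> q x = z" by simp
  then show False using x pq_same z_neq_one by simp
qed

lemma nf_nonzero:
  assumes "u \<in> lists X" "v \<in> lists X"
  shows "nf u v \<noteq> z"
proof
  assume "nf u v = z"
  then have "pos u \<otimes> nf u v \<otimes> neg v = z" using assms by simp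
  moreover have "pos u \<otimes> nf u v \<otimes> neg v = (pos u \<otimes> neg u) \<otimes> (pos v \<otimes> neg v)"
    using assms by (simp add: nf_def m_assoc)
  ultimately show False using assms z_neq_one by (simp add: pos_neg)
qed

text \<open>
  Over a single letter the normal forms would be closed under multiplication, as in the bicyclic
  monoid, and would therefore miss zero.
\<close>
lemma two_letters: "\<exists>x \<in> X. \<exists>y \<in> X. x \<noteq> y"
proof (rule ccontr)
  assume "\<not> ?thesis"
  then have single: "x = y" if "x \<in> X" "y \<in> X" for x y using that by blast
  let ?H = "{nf u v | u v. u \<in> lists X \<and> v \<in> lists X}"
  have "carrier G \<subseteq> ?H"
  proof (rule generated)
    show "\<one> \<in> ?H" by (force simp: nf_def intro: exI[of _ "[]"])
    fix x h assume x: "x \<in> X" and "h \<in> ?H"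
    then obtain u v where uv: "u \<in> lists X" "v \<in> lists X" and h: "h = nf u v" by auto
    have "x # u \<in> lists X" "q x \<otimes> h = nf (x # u) v" using uv x h by (auto simp: nf_Cons_left)
    then show "q x \<otimes> h \<in> ?H" using uv by blast
    show "p x \<otimes> h \<in> ?H"
    proof (cases u)
      case Nil
      have "v @ [x] \<in> lists X" "p x \<otimes> h = nf [] (v @ [x])"
        using x uv h Nil by (auto simp: p_nf_Nil)
      then show ?thesis by blast
    next
      case (Cons y u')
      then have "p x \<otimes> h = nf u' v" "u' \<in> lists X"
        using x uv h single[of x y] by (auto simp: p_nf_Cons)
      then show ?thesis using uv by blast
    qed
  qed auto
  then obtain u v where "u \<in> lists X" "v \<in> lists X" "z = nf u v" using z_closed by blast
  then show False using nf_nonzero by metis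
qed

lemma other_letter:
  obtains y where "y \<in> X" "y \<noteq> x"
  using two_letters by metis

text \<open>
  Left multiplication by a letter other than \<open>x\<close> kills the left-hand side, but it kills no plain word.
\<close>
lemma q_times_neq_pos:
  assumes x: "x \<in> X" and g: "g \<in> carrier G" and v: "v \<in> lists X"
  shows "q x \<otimes> g \<noteq> pos v"
proof
  assume eq: "q x \<otimes> g = pos v"
  obtain y where y: "y \<in> X" "y \<noteq> x" by (rule other_letter)
  have "p y \<otimes> (q x \<otimes> g) = z"
    using x y g by (simp add: m_assoc[symmetric] pq_distinct)
  then have "nf [] (v @ [y]) = z"
    using eq y v p_nf_Nil[of y v] by (simp add: nf_Nil)
  then show False using nf_nonzero[of "[]" "v @ [y]"] y v by simp
qed

lemma pos_inj: "v \<in> lists X \<Longrightarrow> w \<in> lists X \<Longrightarrow> pos v = pos w \<Longrightarrow> v = w"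
proof -
  have Cons_neq_one: "pos (x # v) \<noteq> \<one>" if xv: "x \<in> X" "v \<in> lists X" for x v
  proof
    assume eq: "pos (x # v) = \<one>"
    obtain y where y: "y \<in> X" "y \<noteq> x" by (rule other_letter)
    have "pos (x # v) \<otimes> q y = z"
      using xv y by (simp add: m_assoc pq_distinct)
    then show False using eq y q_nonzero by simp
  qed
  show "v \<in> lists X \<Longrightarrow> w \<in> lists X \<Longrightarrow> pos v = pos w \<Longrightarrow> v = w"
  proof (induction v w rule: list_induct2')
    case (4 x v y w)
    then have X: "x \<in> X" "y \<in> X" "v \<in> lists X" "w \<in> lists X" by auto
    have "nf [] (x # v) \<otimes> q x = nf [] (y # w) \<otimes> q x"
      using 4 X by (simp only: nf_Nil)
    then have "nf [] v = (if x = y then nf [] w else z)"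
      using X by (simp add: nf_q_Cons del: lists.simps)
    then show ?case using 4 X nf_nonzero[of "[]" v] by (auto simp: nf_Nil split: if_splits)
  qed (use Cons_neq_one in \<open>fastforce+\<close>)
qed

lemma nf_inj:
  "u \<in> lists X \<Longrightarrow> v \<in> lists X \<Longrightarrow> s \<in> lists X \<Longrightarrow> t \<in> lists X \<Longrightarrow>
   nf u v = nf s t \<Longrightarrow> u = s \<and> v = t"
proof (induction u s rule: list_induct2')
  case 1
  then show ?case using pos_inj by (simp add: nf_Nil)
next
  case (2 x u)
  then show ?case using q_times_neq_pos[of x "nf u v" t] by (auto simp: nf_Nil nf_Cons_left)
next
  case (3 y s)
  then show ?case using q_times_neq_pos[of y "nf s t" v] by (auto simp: nf_Nil nf_Cons_left)
next
  case (4 x u y s)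
  then have X: "x \<in> X" "y \<in> X" "u \<in> lists X" "s \<in> lists X" by auto
  have "nf u v = p x \<otimes> nf (x # u) v" using X 4(3) by (simp add: p_nf_Cons)
  also have "\<dots> = p x \<otimes> nf (y # s) t" using 4 by simp
  also have "\<dots> = (if x = y then nf s t else z)" using X 4(5) by (simp add: p_nf_Cons)
  finally show ?case using 4 X nf_nonzero[of u v] by (auto split: if_splits)
qed

lemma inj_on_nf: "inj_on (\<lambda>(u, v). nf u v) (lists X \<times> lists X)"
proof (rule inj_onI)
  fix a b assume "a \<in> lists X \<times> lists X" "b \<in> lists X \<times> lists X"
    "(\<lambda>(u, v). nf u v) a = (\<lambda>(u, v). nf u v) b"
  then show "a = b" using nf_inj[of "fst a" "snd a" "fst b" "snd b"]
    by (auto simp: mem_Times_iff case_prod_unfold prod_eq_iff)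
qed

lemma inj_on_p: "inj_on p X"
proof (rule inj_onI)
  fix x y assume "x \<in> X" "y \<in> X" "p x = p y"
  then show "x = y" using pos_inj[of "[x]" "[y]"] by simp
qed

end

section \<open>The generators are determined by the monoid\<close>

definition right_units :: "('a, 'm) monoid_scheme \<Rightarrow> 'a set" where
  "right_units G = {s \<in> carrier G. \<exists>t \<in> carrier G. s \<otimes>\<^bsub>G\<^esub> t = \<one>\<^bsub>G\<^esub>}"

definition indecomposable_right_units :: "('a, 'm) monoid_scheme \<Rightarrow> 'a set" where
  "indecomposable_right_units G = {s \<in> right_units G. s \<noteq> \<one>\<^bsub>G\<^esub> \<and>
     (\<forall>a \<in> right_units G. \<forall>b \<in> right_units G. s = a \<otimes>\<^bsub>G\<^esub> b \<longrightarrow> a = \<one>\<^bsub>G\<^esub> \<or> b = \<one>\<^bsub>G\<^esub>)}"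

context nontrivial_polycyclic_system
begin

lemma right_units_eq: "right_units G = pos ` lists X"
proof (intro equalityI subsetI)
  fix s assume "s \<in> right_units G"
  then obtain t where s: "s \<in> carrier G" and t: "t \<in> carrier G" "s \<otimes> t = \<one>"
    by (auto simp: right_units_def)
  have "s \<noteq> z" using t z_neq_one by auto
  then obtain u v where uv: "u \<in> lists X" "v \<in> lists X" "s = nf u v"
    using s nf_exists by blast
  have "u = []"
  proof (cases u)
    case (Cons x u')
    then have "q x \<otimes> (nf u' v \<otimes> t) = pos []"
      using uv t by (simp add: nf_Cons_left m_assoc)
    then show ?thesis using q_times_neq_pos[of x "nf u' v \<otimes> t" "[]"] uv t Cons by auto
  qed
  then show "s \<in> pos ` lists X" using uv by (simp add: nf_Nil)
next
  fix s assume "s \<in> pos ` lists X"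
  then show "s \<in> right_units G"
    unfolding right_units_def using pos_neg neg_closed pos_closed by blast
qed

text \<open>
  The right units form the free monoid on the generators, and in a free monoid the words that are
  not products of two nonempty ones are the single letters.
\<close>
lemma generators_eq: "p ` X = indecomposable_right_units G"
proof (intro equalityI subsetI)
  fix s assume "s \<in> p ` X"
  then obtain x where x: "x \<in> X" and s: "s = pos [x]" by auto
  have "a = \<one> \<or> b = \<one>" if ab: "a \<in> right_units G" "b \<in> right_units G" "s = a \<otimes> b" for a b
  proof -
    obtain v w where vw: "v \<in> lists X" "w \<in> lists X" "a = pos v" "b = pos w"
      using ab by (auto simp: right_units_eq)
    have "pos [x] = pos (w @ v)" using vw ab s by (simp add: pos_append)
    then have "[x] = w @ v" using pos_inj[of "[x]" "w @ v"] vw x by simp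
    then show ?thesis using vw by (auto simp: Cons_eq_append_conv)
  qed
  moreover have "s \<noteq> \<one>" using pos_inj[of "[x]" "[]"] x s by auto
  moreover have "s \<in> right_units G" unfolding right_units_eq s by (rule imageI) (use x in simp)
  ultimately show "s \<in> indecomposable_right_units G"
    by (auto simp: indecomposable_right_units_def)
next
  fix s assume s: "s \<in> indecomposable_right_units G"
  then obtain v where v: "v \<in> lists X" "s = pos v"
    by (auto simp: indecomposable_right_units_def right_units_eq)
  have "v \<noteq> []" using s v by (auto simp: indecomposable_right_units_def)
  then obtain x w where xw: "v = x # w" "x \<in> X" "w \<in> lists X" using v by (cases v) auto
  have px: "p x = pos [x]" using xw by simp
  have "pos w = \<one> \<or> p x = \<one>"
  proof -
    have "pos w \<in> right_units G" "p x \<in> right_units G"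
      unfolding right_units_eq px by (rule imageI, use xw in simp)+
    moreover have "s = pos w \<otimes> p x" using v xw by simp
    ultimately show ?thesis using s unfolding indecomposable_right_units_def by blast
  qed
  moreover have "p x \<noteq> \<one>" using pos_inj[of "[x]" "[]"] xw(2) by auto
  ultimately show "s \<in> p ` X" using v xw by auto
qed

end

lemma (in polycyclic_system) iso_image:
  assumes f: "f \<in> iso G G'" and G': "monoid G'"
  shows "polycyclic_system G' X (f \<circ> p) (f \<circ> q) (f z)"
proof -
  interpret G': monoid G' by (rule G')
  have hom: "f (a \<otimes> b) = f a \<otimes>\<^bsub>G'\<^esub> f b" if "a \<in> carrier G" "b \<in> carrier G" for a b
    using f that by (auto simp: iso_def hom_def)
  have f_closed: "f a \<in> carrier G'" if "a \<in> carrier G" for a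
    using f that by (auto simp: iso_def bij_betw_def)
  have surj: "f ` carrier G = carrier G'" using f by (auto simp: iso_def bij_betw_def)
  have one: "f \<one> = \<one>\<^bsub>G'\<^esub>"
  proof -
    obtain a where a: "a \<in> carrier G" "f a = \<one>\<^bsub>G'\<^esub>" using surj G'.one_closed by (metis imageE)
    have "f \<one> = f \<one> \<otimes>\<^bsub>G'\<^esub> f a" using a(2) f_closed[OF one_closed] by simp
    also have "\<dots> = f a" using hom[OF one_closed a(1)] a(1) by simp
    finally show ?thesis using a by simp
  qed
  show ?thesis
  proof
    show "is_zero G' (f z)"
      unfolding is_zero_def surj[symmetric] by (auto simp: hom[symmetric])
    fix H assume H: "H \<subseteq> carrier G'" "\<one>\<^bsub>G'\<^esub> \<in> H"
      and Hp: "\<And>x h. x \<in> X \<Longrightarrow> h \<in> H \<Longrightarrow> (f \<circ> p) x \<otimes>\<^bsub>G'\<^esub> h \<in> H"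
      and Hq: "\<And>x h. x \<in> X \<Longrightarrow> h \<in> H \<Longrightarrow> (f \<circ> q) x \<otimes>\<^bsub>G'\<^esub> h \<in> H"
    have "carrier G \<subseteq> {a \<in> carrier G. f a \<in> H}"
      by (rule generated) (use H Hp Hq in \<open>auto simp: one hom\<close>)
    then show "carrier G' \<subseteq> H" unfolding surj[symmetric] by blast
  qed (auto simp: f_closed hom[symmetric] one pq_same pq_distinct)
qed

lemma is_zero_unique: "is_zero G a \<Longrightarrow> is_zero G b \<Longrightarrow> a = b"
  unfolding is_zero_def by metis

text \<open>Both systems describe the same indecomposable right units of the second monoid.\<close>
lemma card_of_letters_iso_invariant:
  assumes G: "nontrivial_polycyclic_system G X p q z"
    and G': "polycyclic_system G' X' p' q' z'"
    and f: "f \<in> iso G G'"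
  shows "|X| =o |X'|"
proof -
  interpret G: nontrivial_polycyclic_system G X p q z by (rule G)
  interpret G': polycyclic_system G' X' p' q' z' by (rule G')
  interpret image: polycyclic_system G' X "f \<circ> p" "f \<circ> q" "f z"
    by (rule G.iso_image[OF f G'.monoid_axioms])
  have z': "z' = f z" using is_zero_unique G'.zero image.zero by metis
  have "f z \<noteq> \<one>\<^bsub>G'\<^esub>"
  proof
    assume eq: "f z = \<one>\<^bsub>G'\<^esub>"
    have closed: "f \<one>\<^bsub>G\<^esub> \<in> carrier G'" using f by (auto simp: iso_def hom_def)
    then have "f \<one>\<^bsub>G\<^esub> = f z \<otimes>\<^bsub>G'\<^esub> f \<one>\<^bsub>G\<^esub>" using eq by simp
    also have "\<dots> = f z" using closed by (rule image.z_left)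
    finally have "\<one>\<^bsub>G\<^esub> = z" using f by (auto simp: iso_def bij_betw_def inj_on_def)
    then show False using G.z_neq_one by simp
  qed
  then interpret image: nontrivial_polycyclic_system G' X "f \<circ> p" "f \<circ> q" "f z"
    by unfold_locales
  interpret G': nontrivial_polycyclic_system G' X' p' q' z'
    using image.z_neq_one z' by unfold_locales simp
  have "bij_betw (f \<circ> p) X (indecomposable_right_units G')"
    "bij_betw p' X' (indecomposable_right_units G')"
    using image.inj_on_p image.generators_eq G'.inj_on_p G'.generators_eq
    by (auto simp: bij_betw_def)
  then show ?thesis
    using card_of_ordIso ordIso_symmetric ordIso_transitive by metis
qed

section \<open>The presented monoid\<close>

context
  fixes X :: "'x set"
begin

abbreviation "words_class w \<equiv> polycyclic_congruence X `` {w}"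
abbreviation "presented \<equiv> quotient_monoid (words_with_zero X) (polycyclic_congruence X)"

lemma presented_mult:
  "a \<in> carrier (words_with_zero X) \<Longrightarrow> b \<in> carrier (words_with_zero X) \<Longrightarrow>
   words_class a \<otimes>\<^bsub>presented\<^esub> words_class b = words_class (a \<otimes>\<^bsub>words_with_zero X\<^esub> b)"
  by (rule quotient_monoid_mult[OF monoid_congruence_polycyclic])

lemma carrier_presented: "carrier presented = words_class ` carrier (words_with_zero X)"
  by (auto simp: quotient_monoid_def quotient_def)

lemma one_presented: "\<one>\<^bsub>presented\<^esub> = words_class (Some [])"
  by (simp add: quotient_monoid_def words_with_zero_def)

lemma monoid_presented: "monoid presented"
proof -
  interpret W: monoid "words_with_zero X" by (rule monoid_words_with_zero)
  have one: "\<one>\<^bsub>presented\<^esub> = words_class \<one>\<^bsub>words_with_zero X\<^esub>" by (simp add: quotient_monoid_def)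
  show ?thesis
    by (rule monoidI) (auto simp: carrier_presented presented_mult one W.m_assoc)
qed

lemma words_class_eqI:
  assumes "(a, b) \<in> polycyclic_congruence X"
  shows "words_class a = words_class b"
  using assms monoid_congruence_polycyclic[of X]
  by (auto simp: monoid_congruence_def intro!: equiv_class_eq)

lemma relators_congruent: "polycyclic_relators X \<subseteq> polycyclic_congruence X"
  by (auto simp: polycyclic_congruence_def congruence_generated_by_def)

text \<open>Two letters are needed because only then is zero a product of generators.\<close>
lemma polycyclic_system_presented:
  assumes two: "x0 \<in> X" "y0 \<in> X" "x0 \<noteq> y0"
  shows "polycyclic_system presented X
    (\<lambda>x. words_class (Some [Pos x])) (\<lambda>x. words_class (Some [Neg x])) (words_class None)"
proof -
  interpret monoid presented by (rule monoid_presented)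
  let ?W = "words_with_zero X"
  have in_W [simp]: "None \<in> carrier ?W" "Some w \<in> carrier ?W \<longleftrightarrow> w \<in> lists (letters X)" for w
    by (auto simp: words_with_zero_def)
  have letters [simp]: "Pos x \<in> letters X \<longleftrightarrow> x \<in> X" "Neg x \<in> letters X \<longleftrightarrow> x \<in> X" for x
    by (auto simp: letters_def)
  have mult_W: "None \<otimes>\<^bsub>?W\<^esub> a = None" "a \<otimes>\<^bsub>?W\<^esub> None = None" "Some v \<otimes>\<^bsub>?W\<^esub> Some w = Some (v @ w)" for a v w
    by (auto simp: words_with_zero_def split: option.splits)
  have distinct: "words_class (Some [Pos x]) \<otimes>\<^bsub>presented\<^esub> words_class (Some [Neg y]) = words_class None"
    if "x \<in> X" "y \<in> X" "x \<noteq> y" for x y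
  proof -
    have "words_class (Some [Pos x, Neg y]) = words_class None"
      by (rule words_class_eqI, rule subsetD[OF relators_congruent])
        (use that in \<open>auto simp: polycyclic_relators_def\<close>)
    then show ?thesis using that by (simp add: presented_mult mult_W)
  qed
  show ?thesis
  proof
    show "is_zero presented (words_class None)"
      by (auto simp: is_zero_def carrier_presented presented_mult mult_W)
    show "words_class (Some [Pos x]) \<otimes>\<^bsub>presented\<^esub> words_class (Some [Neg x]) = \<one>\<^bsub>presented\<^esub>"
      if "x \<in> X" for x
    proof -
      have "words_class (Some [Pos x, Neg x]) = words_class (Some [])"
        by (rule words_class_eqI, rule subsetD[OF relators_congruent])
          (use that in \<open>auto simp: polycyclic_relators_def\<close>)
      then show ?thesis using that by (simp add: presented_mult mult_W one_presented)
    qed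
    fix H assume H: "H \<subseteq> carrier presented" "\<one>\<^bsub>presented\<^esub> \<in> H"
      and Hp: "\<And>x h. x \<in> X \<Longrightarrow> h \<in> H \<Longrightarrow> words_class (Some [Pos x]) \<otimes>\<^bsub>presented\<^esub> h \<in> H"
      and Hq: "\<And>x h. x \<in> X \<Longrightarrow> h \<in> H \<Longrightarrow> words_class (Some [Neg x]) \<otimes>\<^bsub>presented\<^esub> h \<in> H"
    have "words_class (Some w) \<in> H" if "w \<in> lists (letters X)" for w
      using that
    proof (induction w)
      case Nil
      then show ?case using H by (simp add: one_presented)
    next
      case (Cons l w)
      have "words_class (Some [l]) \<otimes>\<^bsub>presented\<^esub> words_class (Some w) = words_class (Some (l # w))"
        using Cons by (simp add: presented_mult mult_W)
      moreover have "(\<exists>x \<in> X. l = Pos x) \<or> (\<exists>x \<in> X. l = Neg x)"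
        using Cons by (auto simp: letters_def)
      ultimately show ?case using Hp Hq Cons by metis
    qed
    moreover have "words_class None \<in> H"
      using Hp[OF two(1) Hq[OF two(2) H(2)]] two distinct
      by (simp add: carrier_presented)
    ultimately show "carrier presented \<subseteq> H"
      unfolding carrier_presented by (auto simp: words_with_zero_def)
  qed (use distinct in \<open>auto simp: carrier_presented\<close>)
qed

end

lemma polycyclic_system_polycyclic:
  assumes "x \<in> Field r" "y \<in> Field r" "x \<noteq> y"
  shows "polycyclic_system (polycyclic r) (Field r)
    (\<lambda>x. polycyclic_congruence (Field r) `` {Some [Pos x]})
    (\<lambda>x. polycyclic_congruence (Field r) `` {Some [Neg x]}) (polycyclic_zero r)"
  using polycyclic_system_presented[OF assms] by (simp add: polycyclic_def polycyclic_zero_def)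

text \<open>
  A homomorphism preserves normal forms, and those of the target are pairwise distinct and nonzero.
\<close>
lemma (in nontrivial_polycyclic_system) iso_if_generators_preserved:
  assumes P: "polycyclic_system P X p' q' z'" and h: "h \<in> hom P G"
    and hp: "\<And>x. x \<in> X \<Longrightarrow> h (p' x) = p x" and hq: "\<And>x. x \<in> X \<Longrightarrow> h (q' x) = q x"
    and h1: "h \<one>\<^bsub>P\<^esub> = \<one>" and hz: "h z' = z"
  shows "h \<in> iso P G"
proof -
  interpret P: polycyclic_system P X p' q' z' by (rule P)
  have mult: "h (a \<otimes>\<^bsub>P\<^esub> b) = h a \<otimes> h b" if "a \<in> carrier P" "b \<in> carrier P" for a b
    using h that by (auto simp: hom_def)
  have hpos: "h (P.pos v) = pos v" if "v \<in> lists X" for v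
    using that by (induction v) (auto simp: mult hp h1)
  have hneg: "h (P.neg v) = neg v" if "v \<in> lists X" for v
    using that by (induction v) (auto simp: mult hq h1)
  have hnf: "h (P.nf u v) = nf u v" if "u \<in> lists X" "v \<in> lists X" for u v
    using that by (simp add: P.nf_def nf_def mult hpos hneg)
  have "inj_on h (carrier P)"
  proof (rule inj_onI)
    fix a b assume ab: "a \<in> carrier P" "b \<in> carrier P" "h a = h b"
    show "a = b"
    proof (cases "a = z'")
      case True
      show ?thesis
      proof (rule ccontr)
        assume "a \<noteq> b"
        then obtain u v where "u \<in> lists X" "v \<in> lists X" "b = P.nf u v"
          using P.nf_exists[of b] ab True by metis
        then show False using hnf nf_nonzero ab hz True by metis
      qed
    next
      case False
      then obtain u v where uv: "u \<in> lists X" "v \<in> lists X" "a = P.nf u v"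
        using P.nf_exists[of a] ab by metis
      have "b \<noteq> z'" using hnf nf_nonzero ab hz uv by metis
      then obtain s t where "s \<in> lists X" "t \<in> lists X" "b = P.nf s t"
        using P.nf_exists[of b] ab by metis
      then show ?thesis using uv hnf nf_inj ab by metis
    qed
  qed
  moreover have "h ` carrier P = carrier G"
  proof (intro equalityI subsetI)
    fix s assume s: "s \<in> carrier G"
    show "s \<in> h ` carrier P"
    proof (cases "s = z")
      case True
      then show ?thesis using hz P.z_closed by blast
    next
      case False
      then obtain u v where "u \<in> lists X" "v \<in> lists X" "s = nf u v"
        using nf_exists[of s] s by metis
      then show ?thesis using hnf P.nf_closed by (metis imageI)
    qed
  qed (use h in \<open>auto simp: hom_def\<close>)
  ultimately show ?thesis using h by (simp add: iso_def bij_betw_def)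
qed

context polycyclic_system
begin

primrec letter_value :: "'x letter \<Rightarrow> 'a" where
  "letter_value (Pos x) = p x"
| "letter_value (Neg x) = q x"

primrec word_value :: "'x letter list \<Rightarrow> 'a" where
  "word_value [] = \<one>"
| "word_value (l # w) = letter_value l \<otimes> word_value w"

definition zword_value :: "'x letter list option \<Rightarrow> 'a" where
  "zword_value a = (case a of None \<Rightarrow> z | Some w \<Rightarrow> word_value w)"

lemma letter_value_closed [simp, intro]: "l \<in> letters X \<Longrightarrow> letter_value l \<in> carrier G"
  by (auto simp: letters_def)

lemma word_value_closed [simp, intro]: "w \<in> lists (letters X) \<Longrightarrow> word_value w \<in> carrier G"
  by (induction w) auto

lemma word_value_append:
  "v \<in> lists (letters X) \<Longrightarrow> w \<in> lists (letters X) \<Longrightarrow>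
   word_value (v @ w) = word_value v \<otimes> word_value w"
  by (induction v) (auto simp: m_assoc)

lemma zword_value_hom: "zword_value \<in> hom (words_with_zero X) G"
proof (rule homI)
  fix a b assume ab: "a \<in> carrier (words_with_zero X)" "b \<in> carrier (words_with_zero X)"
  have cases: "a = None \<or> (\<exists>w. a = Some w \<and> w \<in> lists (letters X))"
    if "a \<in> carrier (words_with_zero X)" for a
    using that unfolding words_with_zero_def by (simp only: partial_object.simps) blast
  show "zword_value a \<in> carrier G"
    using cases[OF ab(1)] unfolding zword_value_def by (elim disjE exE conjE) simp_all
  show "zword_value (a \<otimes>\<^bsub>words_with_zero X\<^esub> b) = zword_value a \<otimes> zword_value b"
    using cases[OF ab(1)] cases[OF ab(2)] unfolding zword_value_def words_with_zero_def
    by (elim disjE exE conjE) (simp_all add: word_value_append)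
qed

text \<open>The kernel of the evaluation is a congruence that contains the relators.\<close>
lemma zword_value_congruent:
  assumes "(a, b) \<in> polycyclic_congruence X"
  shows "zword_value a = zword_value b"
proof -
  let ?W = "words_with_zero X"
  let ?K = "{(a, b) \<in> carrier ?W \<times> carrier ?W. zword_value a = zword_value b}"
  interpret W: monoid ?W by (rule monoid_words_with_zero)
  have "monoid_congruence ?W ?K"
    using zword_value_hom
    by (auto simp: monoid_congruence_def equiv_def refl_on_def sym_def trans_def hom_def)
  moreover have "polycyclic_relators X \<subseteq> ?K"
    by (auto simp: polycyclic_relators_def words_with_zero_def letters_def zword_value_def
        pq_same pq_distinct)
  ultimately have "polycyclic_congruence X \<subseteq> ?K"
    unfolding polycyclic_congruence_def congruence_generated_by_def by blast
  then show ?thesis using assms by blast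
qed

end

lemma (in nontrivial_polycyclic_system) presented_iso:
  "\<exists>h. h \<in> iso (quotient_monoid (words_with_zero X) (polycyclic_congruence X)) G"
proof -
  let ?W = "words_with_zero X" and ?R = "polycyclic_congruence X"
  let ?P = "quotient_monoid ?W ?R"
  interpret W: monoid ?W by (rule monoid_words_with_zero)
  define h where "h C = zword_value (SOME a. a \<in> C)" for C
  have h_class: "h (?R `` {a}) = zword_value a" if "a \<in> carrier ?W" for a
  proof -
    have "(a, a) \<in> ?R"
      using monoid_congruence_polycyclic[of X] that
      by (auto simp: monoid_congruence_def equiv_def refl_on_def)
    then have "a \<in> ?R `` {a}" by simp
    then have "(SOME b. b \<in> ?R `` {a}) \<in> ?R `` {a}" by (rule someI)
    then have "(a, SOME b. b \<in> ?R `` {a}) \<in> ?R" by simp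
    from zword_value_congruent[OF this] show ?thesis by (simp add: h_def)
  qed
  have hom: "h \<in> hom ?P G"
    using zword_value_hom
    by (auto simp: hom_def carrier_presented presented_mult h_class)
  obtain x y where xy: "x \<in> X" "y \<in> X" "x \<noteq> y" using two_letters by blast
  have in_W: "None \<in> carrier ?W" "Some [] \<in> carrier ?W"
    "\<And>x. x \<in> X \<Longrightarrow> Some [Pos x] \<in> carrier ?W" "\<And>x. x \<in> X \<Longrightarrow> Some [Neg x] \<in> carrier ?W"
    by (auto simp: words_with_zero_def letters_def)
  have "h \<in> iso ?P G"
    by (rule iso_if_generators_preserved[OF polycyclic_system_presented[OF xy] hom])
      (simp_all add: one_presented h_class in_W zword_value_def)
  then show ?thesis by blast
qed

section \<open>Hausdorff semitopological polycyclic monoids\<close>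

lemma openin_singleton_if_finite_fibre:
  assumes T1: "t1_space T" and f: "continuous_map T T f" and a: "a \<in> topspace T"
    and fa: "openin T {f a}" and fin: "finite {s \<in> topspace T. f s = f a}"
  shows "openin T {a}"
proof -
  let ?F = "{s \<in> topspace T. f s = f a}"
  have "openin T {s \<in> topspace T. f s \<in> {f a}}"
    by (rule openin_continuous_map_preimage[OF f fa])
  then have "openin T ?F" by simp
  moreover have "closedin T (?F - {a})"
    using T1 fin by (auto simp: t1_space_closedin_finite)
  ultimately have "openin T (?F - (?F - {a}))" by (rule openin_diff)
  moreover have "?F - (?F - {a}) = {a}" using a by auto
  ultimately show ?thesis by simp
qed

lemma finite_compactin_isolated:
  assumes "compactin T K" "\<And>s. s \<in> K \<Longrightarrow> openin T {s}"
  shows "finite K"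
proof -
  have "\<exists>\<F>. finite \<F> \<and> \<F> \<subseteq> (\<lambda>s. {s}) ` K \<and> K \<subseteq> \<Union> \<F>"
    using assms by (intro compactinD) auto
  then obtain \<F> where \<F>: "finite \<F>" "\<F> \<subseteq> (\<lambda>s. {s}) ` K" "K \<subseteq> \<Union> \<F>" by blast
  then have "finite (\<Union> \<F>)" by auto
  then show ?thesis using \<F> finite_subset by blast
qed

locale semitopological_polycyclic_system = nontrivial_polycyclic_system +
  fixes T :: "'a topology"
  assumes topspace [simp]: "topspace T = carrier G"
    and Hausdorff: "Hausdorff_space T"
    and left_cont: "a \<in> carrier G \<Longrightarrow> continuous_map T T (\<lambda>s. a \<otimes> s)"
    and right_cont: "a \<in> carrier G \<Longrightarrow> continuous_map T T (\<lambda>s. s \<otimes> a)"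
begin

lemma t1: "t1_space T"
  using Hausdorff by (rule Hausdorff_imp_t1_space)

lemma openin_one: "openin T {\<one>}"
proof -
  obtain x y where xy: "x \<in> X" "y \<in> X" "x \<noteq> y" using two_letters by blast
  have U: "openin T (carrier G - {z})"
    using t1 by (metis t1_space_openin_delete_alt openin_topspace topspace)
  let ?V = "\<lambda>f. {s \<in> topspace T. f s \<in> carrier G - {z}}"
  have "openin T (?V (\<lambda>s. p x \<otimes> s) \<inter> ?V (\<lambda>s. p y \<otimes> s) \<inter>
      (?V (\<lambda>s. s \<otimes> q x) \<inter> ?V (\<lambda>s. s \<otimes> q y)))"
    using xy by (intro openin_Int openin_continuous_map_preimage[OF _ U] left_cont right_cont) auto
  moreover have "?V (\<lambda>s. p x \<otimes> s) \<inter> ?V (\<lambda>s. p y \<otimes> s) \<inter>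
      (?V (\<lambda>s. s \<otimes> q x) \<inter> ?V (\<lambda>s. s \<otimes> q y)) = {\<one>}" (is "?I = _")
  proof (intro equalityI subsetI)
    fix s assume s: "s \<in> ?I"
    then have "s \<noteq> z" "s \<in> carrier G" using xy by auto
    then obtain u v where uv: "u \<in> lists X" "v \<in> lists X" "s = nf u v"
      using nf_exists by metis
    have "u = []"
    proof (cases u)
      case (Cons w u')
      then show ?thesis using uv xy s by (auto simp: p_nf_Cons split: if_splits)
    qed
    moreover have "v = []"
    proof (cases v)
      case (Cons w v')
      then show ?thesis using uv xy s by (auto simp: nf_q_Cons split: if_splits)
    qed
    ultimately show "s \<in> {\<one>}" using uv by (simp add: nf_def)
  qed (use xy p_nonzero q_nonzero in auto)
  ultimately show ?thesis by simp
qed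

text \<open>
  Besides \<open>x\<inverse> u\<inverse> v\<close>, the fibre can contain only a plain word that left multiplication by \<open>x\<close>
  lengthens at its inner end.
\<close>
lemma finite_fibre_p:
  assumes "x \<in> X" "u \<in> lists X" "v \<in> lists X"
  shows "finite {s \<in> carrier G. p x \<otimes> s = nf u v}"
proof (rule finite_subset)
  show "{s \<in> carrier G. p x \<otimes> s = nf u v} \<subseteq> {nf (x # u) v, nf [] (butlast v)}"
  proof
    fix s assume "s \<in> {s \<in> carrier G. p x \<otimes> s = nf u v}"
    then have s: "s \<in> carrier G" "p x \<otimes> s = nf u v" by auto
    have "s \<noteq> z"
    proof
      assume "s = z"
      then have "nf u v = z" using s(2) assms(1) by simp
      then show False using nf_nonzero assms by simp
    qed
    then obtain a b where ab: "a \<in> lists X" "b \<in> lists X" "s = nf a b"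
      using s nf_exists by metis
    show "s \<in> {nf (x # u) v, nf [] (butlast v)}"
    proof (cases a)
      case Nil
      then have "nf [] (b @ [x]) = nf u v" using ab s assms by (simp add: p_nf_Nil)
      then have "v = b @ [x]" using nf_inj[of "[]" "b @ [x]" u v] ab assms by auto
      then show ?thesis using s ab Nil by simp
    next
      case (Cons y a')
      then have "(if x = y then nf a' b else z) = nf u v"
        using ab s assms by (simp add: p_nf_Cons)
      then show ?thesis
        using Cons ab assms nf_nonzero[of u v] nf_inj[of a' b u v] by (auto split: if_splits)
    qed
  qed
qed simp

lemma finite_fibre_q:
  assumes "x \<in> X" "v \<in> lists X"
  shows "finite {s \<in> carrier G. s \<otimes> q x = pos v}"
proof (rule finite_subset)
  show "{s \<in> carrier G. s \<otimes> q x = pos v} \<subseteq> {pos (x # v)}"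
  proof clarify
    fix s assume s: "s \<in> carrier G" "s \<otimes> q x = pos v"
    have "s \<noteq> z" using s assms nf_nonzero[of "[]" v] by (auto simp: nf_Nil)
    then obtain a b where ab: "a \<in> lists X" "b \<in> lists X" "s = nf a b"
      using s nf_exists by metis
    have "a = []"
    proof (cases a)
      case (Cons y a')
      then have "q y \<otimes> (nf a' b \<otimes> q x) = pos v"
        using ab s assms by (simp add: nf_Cons_left m_assoc)
      then show ?thesis using q_times_neq_pos[of y "nf a' b \<otimes> q x" v] Cons ab assms by auto
    qed
    show "s = pos (x # v)"
    proof (cases b)
      case Nil
      then have "q x \<otimes> \<one> = pos v" using \<open>a = []\<close> ab s assms by (simp add: nf_def)
      then show ?thesis using q_times_neq_pos[of x \<one> v] assms by auto
    next
      case (Cons y b')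
      then have "(if x = y then nf [] b' else z) = nf [] v"
        using ab s assms \<open>a = []\<close> nf_q_Cons[of x y "[]" b'] by (simp add: nf_Nil)
      then show ?thesis
        using Cons ab assms nf_nonzero[of "[]" v] nf_inj[of "[]" b' "[]" v] \<open>a = []\<close>
        by (auto simp: nf_Nil split: if_splits)
    qed
  qed
qed simp

lemma nonzero_isolated:
  assumes "s \<in> carrier G" "s \<noteq> z"
  shows "openin T {s}"
proof -
  have pos_open: "openin T {pos v}" if "v \<in> lists X" for v
    using that
  proof (induction v)
    case (Cons x v)
    have fa: "pos (x # v) \<otimes> q x = pos v" using Cons by (simp add: m_assoc pq_same)
    show ?case
      by (rule openin_singleton_if_finite_fibre[OF t1 right_cont[of "q x"]])
        (use Cons finite_fibre_q[of x v] fa in auto)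
  qed (simp add: openin_one)
  have nf_open: "openin T {nf u v}" if "u \<in> lists X" "v \<in> lists X" for u v
    using that
  proof (induction u)
    case (Cons x u)
    have fa: "p x \<otimes> nf (x # u) v = nf u v" using Cons by (simp add: p_nf_Cons)
    show ?case
      by (rule openin_singleton_if_finite_fibre[OF t1 left_cont[of "p x"]])
        (use Cons finite_fibre_p[of x u v] fa in auto)
  qed (simp add: nf_Nil pos_open)
  show ?thesis using nf_exists[OF assms] nf_open by metis
qed

lemma openin_if_zero_notin:
  assumes "U \<subseteq> carrier G" "z \<notin> U"
  shows "openin T U"
proof -
  have "openin T (\<Union>s \<in> U. {s})" using assms by (intro openin_Union) (auto intro!: nonzero_isolated)
  then show ?thesis by simp
qed

lemma finite_compact_minus_open:
  assumes "compactin T K" "openin T U" "z \<in> U"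
  shows "finite (K - U)"
proof (rule finite_compactin_isolated)
  have "compactin T (K \<inter> (topspace T - U))"
    using assms by (intro compact_Int_closedin closedin_diff closedin_topspace)
  moreover have "K \<inter> (topspace T - U) = K - U" using compactin_subset_topspace[OF assms(1)] by auto
  ultimately show "compactin T (K - U)" by simp
  show "openin T {s}" if "s \<in> K - U" for s
    using that assms compactin_subset_topspace[OF assms(1)] by (intro nonzero_isolated) auto
qed

text \<open>
  Points leaving \<open>K\<close> lie in a compact set that misses zero; points entering \<open>K\<close> are points leaving it
  under the translation that undoes \<open>f\<close>.
\<close>
lemma finite_boundary_of_translation:
  assumes K: "compactin T K" "openin T K" "z \<in> K"
    and f: "continuous_map T T f" "f z = z" and g: "continuous_map T T g" "g z = z"
    and gf: "\<And>s. s \<in> carrier G \<Longrightarrow> g (f s) = s"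
  shows "finite {s \<in> carrier G. (f s \<in> K) \<noteq> (s \<in> K)}"
proof -
  have leave: "finite {s \<in> K. k s \<notin> K}" if k: "continuous_map T T k" "k z = z" for k
  proof -
    have "finite (K - {s \<in> topspace T. k s \<in> K})"
      by (rule finite_compact_minus_open[OF K(1) openin_continuous_map_preimage[OF k(1) K(2)]])
        (use K k in auto)
    then show ?thesis by (rule rev_finite_subset) auto
  qed
  have "{s \<in> carrier G. (f s \<in> K) \<noteq> (s \<in> K)} \<subseteq> {s \<in> K. f s \<notin> K} \<union> g ` {t \<in> K. g t \<notin> K}"
  proof
    fix s assume s: "s \<in> {s \<in> carrier G. (f s \<in> K) \<noteq> (s \<in> K)}"
    show "s \<in> {s \<in> K. f s \<notin> K} \<union> g ` {t \<in> K. g t \<notin> K}"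
    proof (cases "s \<in> K")
      case False
      then have "f s \<in> {t \<in> K. g t \<notin> K}" "s = g (f s)" using s gf by auto
      then show ?thesis by blast
    qed (use s in auto)
  qed
  moreover have "finite \<dots>" using leave f g by blast
  ultimately show ?thesis by (rule finite_subset)
qed

lemma compact_open_finite_or_cofinite:
  assumes K: "compactin T K" "openin T K" "z \<in> K"
  shows "finite K \<or> finite (carrier G - K)"
proof -
  let ?W = "lists X"
  have pull_back: "finite {(u, v) \<in> ?W \<times> ?W. P u v}"
    if "finite S" "\<And>u v. u \<in> ?W \<Longrightarrow> v \<in> ?W \<Longrightarrow> P u v \<Longrightarrow> nf u v \<in> S" for P S
  proof (rule inj_on_finite[OF _ _ that(1), where f = "\<lambda>(u, v). nf u v"])
    show "inj_on (\<lambda>(u, v). nf u v) {(u, v) \<in> ?W \<times> ?W. P u v}"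
      by (rule inj_on_subset[OF inj_on_nf]) auto
  qed (use that(2) in auto)
  have push: "finite {s \<in> carrier G - {z}. P s}"
    if fin: "finite {(u, v) \<in> ?W \<times> ?W. P (nf u v)}" for P
  proof (rule finite_surj[OF fin])
    show "{s \<in> carrier G - {z}. P s} \<subseteq> (\<lambda>(u, v). nf u v) ` {(u, v) \<in> ?W \<times> ?W. P (nf u v)}"
    proof
      fix s assume "s \<in> {s \<in> carrier G - {z}. P s}"
      then have s: "s \<in> carrier G" "s \<noteq> z" "P s" by auto
      then obtain u v where "u \<in> ?W" "v \<in> ?W" "s = nf u v" using nf_exists by metis
      then show "s \<in> (\<lambda>(u, v). nf u v) ` {(u, v) \<in> ?W \<times> ?W. P (nf u v)}"
        using s by (intro image_eqI[of _ _ "(u, v)"]) auto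
    qed
  qed
  obtain x where x: "x \<in> X" using two_letters by blast
  have "finite {(u, v) \<in> ?W \<times> ?W. nf u v \<in> K} \<or> finite {(u, v) \<in> ?W \<times> ?W. \<not> nf u v \<in> K}"
  proof (rule finite_or_cofinite_if_finite_boundary[OF x])
    fix y assume y: "y \<in> X"
    have "finite {s \<in> carrier G. (q y \<otimes> s \<in> K) \<noteq> (s \<in> K)}"
      by (rule finite_boundary_of_translation[OF K left_cont[of "q y"] _ left_cont[of "p y"]])
        (use y in \<open>auto simp: m_assoc[symmetric] pq_same\<close>)
    then show "finite {(u, v) \<in> ?W \<times> ?W. (nf (y # u) v \<in> K) \<noteq> (nf u v \<in> K)}"
      by (rule pull_back) (use y in \<open>auto simp: nf_Cons_left\<close>)
    have "finite {s \<in> carrier G. (s \<otimes> p y \<in> K) \<noteq> (s \<in> K)}"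
      by (rule finite_boundary_of_translation[OF K right_cont[of "p y"] _ right_cont[of "q y"]])
        (use y in \<open>auto simp: m_assoc pq_same\<close>)
    then show "finite {(u, v) \<in> ?W \<times> ?W. (nf u (y # v) \<in> K) \<noteq> (nf u v \<in> K)}"
      by (rule pull_back) (use y in \<open>auto simp: nf_Cons_right\<close>)
  qed
  then have "finite {s \<in> carrier G - {z}. s \<in> K} \<or> finite {s \<in> carrier G - {z}. s \<notin> K}"
    using push[of "\<lambda>s. s \<in> K"] push[of "\<lambda>s. s \<notin> K"] by blast
  moreover have "K \<subseteq> insert z {s \<in> carrier G - {z}. s \<in> K}"
    using openin_subset[OF K(2)] by auto
  moreover have "carrier G - K \<subseteq> {s \<in> carrier G - {z}. s \<notin> K}" using K by auto
  ultimately show ?thesis by (meson finite_insert finite_subset)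
qed

lemma discrete_or_compact:
  assumes lc: "locally_compact_space T"
  shows "T = discrete_topology (carrier G) \<or>
    compact_space T \<and>
    (\<forall>U. openin T U \<longleftrightarrow> U \<subseteq> carrier G \<and> (z \<in> U \<longrightarrow> finite (carrier G - U)))"
proof (cases "openin T {z}")
  case True
  then have "\<forall>s \<in> carrier G. openin T {s}" using nonzero_isolated by blast
  then have "discrete_topology (carrier G) = T" by (simp add: discrete_topology_unique)
  then show ?thesis by simp
next
  case False
  obtain U K where UK: "openin T U" "compactin T K" "z \<in> U" "U \<subseteq> K"
    using lc z_closed unfolding locally_compact_space_def by (metis topspace)
  have KG: "K \<subseteq> carrier G" using UK compactin_subset_topspace by fastforce
  have "openin T (K - U)" using UK KG by (intro openin_if_zero_notin) auto
  then have "openin T (U \<union> (K - U))" using UK(1) by (intro openin_Un)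
  moreover have "U \<union> (K - U) = K" using UK by auto
  ultimately have K: "compactin T K" "openin T K" "z \<in> K" using UK by auto
  have "infinite K"
  proof
    assume "finite K"
    then have "closedin T (K - {z})" using t1 KG by (auto simp: t1_space_closedin_finite)
    then have "openin T (K - (K - {z}))" using K by blast
    moreover have "K - (K - {z}) = {z}" using K by auto
    ultimately show False using False by simp
  qed
  then have cofin: "finite (carrier G - K)" using compact_open_finite_or_cofinite[OF K] by blast
  have "compactin T (K \<union> (carrier G - K))"
    using cofin by (intro compactin_Un[OF K(1)] finite_imp_compactin) auto
  moreover have "K \<union> (carrier G - K) = carrier G" using KG by auto
  ultimately have compact: "compact_space T" by (simp add: compact_space_def)
  have "openin T U \<longleftrightarrow> U \<subseteq> carrier G \<and> (z \<in> U \<longrightarrow> finite (carrier G - U))" for U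
  proof
    assume U: "openin T U"
    have "finite (carrier G - U)" if "z \<in> U"
      using finite_compact_minus_open[of "carrier G" U] compact U that by (simp add: compact_space_def)
    then show "U \<subseteq> carrier G \<and> (z \<in> U \<longrightarrow> finite (carrier G - U))"
      using openin_subset[OF U] by simp
  next
    assume U: "U \<subseteq> carrier G \<and> (z \<in> U \<longrightarrow> finite (carrier G - U))"
    show "openin T U"
    proof (cases "z \<in> U")
      case True
      then have "closedin T (carrier G - U)" using U t1 by (auto simp: t1_space_closedin_finite)
      then have "openin T (topspace T - (carrier G - U))" by blast
      moreover have "topspace T - (carrier G - U) = U" using U by auto
      ultimately show ?thesis by simp
    qed (use U openin_if_zero_notin in auto)
  qed
  then show ?thesis using compact by blast
qed

end

section \<open>The classification\<close>

lemma polycyclic_monoid_obtains_system: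
  assumes "polycyclic_monoid S"
  obtains \<Lambda> z where "nontrivial_polycyclic_system S \<Lambda> id (sg_inverse S) z"
proof -
  obtain z \<Lambda> where inv: "inverse_monoid S" and z: "is_zero S z" "z \<noteq> \<one>\<^bsub>S\<^esub>"
    and \<Lambda>: "\<Lambda> \<subseteq> carrier S" "inverse_generated_by S \<Lambda>"
    and same: "\<forall>x\<in>\<Lambda>. x \<otimes>\<^bsub>S\<^esub> sg_inverse S x = \<one>\<^bsub>S\<^esub>"
    and dist: "\<forall>x\<in>\<Lambda>. \<forall>y\<in>\<Lambda>. x \<noteq> y \<longrightarrow> x \<otimes>\<^bsub>S\<^esub> sg_inverse S y = z"
    using assms unfolding polycyclic_monoid_def by blast
  interpret monoid S using inv by (simp add: inverse_monoid_def)
  have inv_closed: "sg_inverse S x \<in> carrier S" if "x \<in> \<Lambda>" for x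
  proof -
    have "\<exists>!b. is_sg_inverse S x b" using inv that \<Lambda> by (auto simp: inverse_monoid_def)
    then have "is_sg_inverse S x (sg_inverse S x)" unfolding sg_inverse_def by (rule theI')
    then show ?thesis by (simp add: is_sg_inverse_def)
  qed
  have "nontrivial_polycyclic_system S \<Lambda> id (sg_inverse S) z"
  proof
    fix H assume H: "H \<subseteq> carrier S" "\<one>\<^bsub>S\<^esub> \<in> H"
      and Hp: "\<And>x h. x \<in> \<Lambda> \<Longrightarrow> h \<in> H \<Longrightarrow> id x \<otimes>\<^bsub>S\<^esub> h \<in> H"
      and Hq: "\<And>x h. x \<in> \<Lambda> \<Longrightarrow> h \<in> H \<Longrightarrow> sg_inverse S x \<otimes>\<^bsub>S\<^esub> h \<in> H"
    \<comment> \<open>\<open>H\<close> need not be a subsemigroup, but the elements that map it into itself form one.\<close>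
    let ?E = "{a \<in> carrier S. \<forall>h \<in> H. a \<otimes>\<^bsub>S\<^esub> h \<in> H}"
    have "subsemigroup ?E S"
      using H(1) by (auto simp: subsemigroup_def m_assoc subset_iff)
    moreover have "\<Lambda> \<union> sg_inverse S ` \<Lambda> \<subseteq> ?E"
      using \<Lambda>(1) inv_closed Hp Hq by auto
    ultimately have "carrier S \<subseteq> ?E"
      using \<Lambda>(2) unfolding inverse_generated_by_def by blast
    then show "carrier S \<subseteq> H" using H(2) by force
  qed (use z \<Lambda> same dist inv_closed in auto)
  then show ?thesis by (rule that)
qed

lemma (in monoid) inv_into_iso:
  assumes "h \<in> iso G H"
  shows "inv_into (carrier G) h \<in> iso H G"
proof -
  let ?g = "inv_into (carrier G) h"
  have h: "bij_betw h (carrier G) (carrier H)"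
    and mult: "\<And>a b. a \<in> carrier G \<Longrightarrow> b \<in> carrier G \<Longrightarrow> h (a \<otimes> b) = h a \<otimes>\<^bsub>H\<^esub> h b"
    using assms by (auto simp: iso_def hom_def)
  have g: "bij_betw ?g (carrier H) (carrier G)" using h by (rule bij_betw_inv_into)
  have gG: "?g c \<in> carrier G" and hg: "h (?g c) = c" if "c \<in> carrier H" for c
    using that bij_betw_apply[OF g] bij_betw_inv_into_right[OF h] by auto
  have "?g (c \<otimes>\<^bsub>H\<^esub> d) = ?g c \<otimes> ?g d" if "c \<in> carrier H" "d \<in> carrier H" for c d
  proof -
    have "c \<otimes>\<^bsub>H\<^esub> d = h (?g c \<otimes> ?g d)" using that by (simp add: mult gG hg)
    then show ?thesis using bij_betw_inv_into_left[OF h m_closed[OF gG gG]] that by simp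
  qed
  then show ?thesis using g gG by (simp add: iso_def hom_def)
qed

lemma cardinal_ge_2_two_elements:
  assumes "cardinal_ge_2 r"
  obtains x y where "x \<in> Field r" "y \<in> Field r" "x \<noteq> y"
proof -
  have "|UNIV :: bool set| \<le>o |Field r|"
    using assms card_of_Field_ordIso ordIso_symmetric ordLeq_ordIso_trans
    unfolding cardinal_ge_2_def ctwo_def by blast
  then obtain f :: "bool \<Rightarrow> 'a" where "inj f" "range f \<subseteq> Field r"
    unfolding card_of_ordLeq[symmetric] by blast
  then show ?thesis using that[of "f True" "f False"] by (auto simp: inj_def)
qed

lemma cardinal_ge_2_card_of:
  assumes "x \<in> A" "y \<in> A" "x \<noteq> y"
  shows "cardinal_ge_2 |A|"
proof -
  have "inj (\<lambda>b. if b then x else y)" "range (\<lambda>b. if b then x else y) \<subseteq> A"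
    using assms by (auto simp: inj_def)
  then have "|UNIV :: bool set| \<le>o |A|" unfolding card_of_ordLeq[symmetric] by blast
  then show ?thesis by (simp add: cardinal_ge_2_def ctwo_def card_of_Card_order)
qed

lemma homeomorphic_map_bij_betw:
  assumes "bij_betw f (topspace T) (topspace T')"
    and "\<And>U. U \<subseteq> topspace T \<Longrightarrow> openin T' (f ` U) \<longleftrightarrow> openin T U"
  shows "homeomorphic_map T T' f"
proof -
  have inj: "inj_on f (topspace T)" and surj: "f ` topspace T = topspace T'"
    using assms(1) by (auto simp: bij_betw_def)
  have "openin T {x \<in> topspace T. f x \<in> U} \<longleftrightarrow> openin T' U" if "U \<subseteq> topspace T'" for U
  proof -
    have "f ` {x \<in> topspace T. f x \<in> U} = U" using that surj by auto
    then show ?thesis using assms(2)[of "{x \<in> topspace T. f x \<in> U}"] by auto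
  qed
  then show ?thesis using inj surj by (auto simp: homeomorphic_map_def quotient_map_def)
qed

lemma topspace_polycyclic_compact_topology:
  "topspace (polycyclic_compact_topology r) = carrier (polycyclic r)"
proof -
  have "openin (polycyclic_compact_topology r) (carrier (polycyclic r))"
    by (simp add: openin_polycyclic_compact_topology)
  then show ?thesis
    using openin_subset openin_topspace by (metis openin_polycyclic_compact_topology subset_antisym)
qed

theorem mainTheorem1:
  fixes S :: "('a, 'm) monoid_scheme" and T :: "'a topology"
  assumes "lc_semitopological_polycyclic_monoid S T"
  shows "(T = discrete_topology (carrier S) \<or> compact_space T) \<and>
    (\<exists>\<kappa> :: 'a rel.
       cardinal_ge_2 \<kappa> \<and>
       (topologically_isomorphic S T (polycyclic \<kappa>) (polycyclic_discrete_topology \<kappa>) \<or>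
        topologically_isomorphic S T (polycyclic \<kappa>) (polycyclic_compact_topology \<kappa>)) \<and>
       (\<forall>\<mu> :: 'b rel.
          cardinal_ge_2 \<mu> \<and>
          (topologically_isomorphic S T (polycyclic \<mu>) (polycyclic_discrete_topology \<mu>) \<or>
           topologically_isomorphic S T (polycyclic \<mu>) (polycyclic_compact_topology \<mu>))
          \<longrightarrow> \<mu> =o \<kappa>))"
proof -
  have poly: "polycyclic_monoid S" and lc: "locally_compact_space T"
    using assms by (auto simp: lc_semitopological_polycyclic_monoid_def)
  obtain \<Lambda> z where sys: "nontrivial_polycyclic_system S \<Lambda> id (sg_inverse S) z"
    using polycyclic_monoid_obtains_system[OF poly] .
  interpret S: nontrivial_polycyclic_system S \<Lambda> id "sg_inverse S" z by (rule sys)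
  interpret S: semitopological_polycyclic_system S \<Lambda> id "sg_inverse S" z T
    using assms by unfold_locales (auto simp: lc_semitopological_polycyclic_monoid_def)
  note dichotomy = S.discrete_or_compact[OF lc]
  define \<kappa> where "\<kappa> = |\<Lambda>|"
  have Field: "Field \<kappa> = \<Lambda>" by (simp add: \<kappa>_def Field_card_of)
  obtain x y where xy: "x \<in> \<Lambda>" "y \<in> \<Lambda>" "x \<noteq> y" using S.two_letters by blast
  have \<kappa>2: "cardinal_ge_2 \<kappa>" unfolding \<kappa>_def using xy by (rule cardinal_ge_2_card_of)
  interpret P: polycyclic_system "polycyclic \<kappa>" "Field \<kappa>"
    "\<lambda>x. polycyclic_congruence (Field \<kappa>) `` {Some [Pos x]}"
    "\<lambda>x. polycyclic_congruence (Field \<kappa>) `` {Some [Neg x]}" "polycyclic_zero \<kappa>"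
    using xy by (intro polycyclic_system_polycyclic) (auto simp: Field)
  obtain h where "h \<in> iso (polycyclic \<kappa>) S"
    using S.presented_iso by (auto simp: polycyclic_def Field)
  then have f: "inv_into (carrier (polycyclic \<kappa>)) h \<in> iso S (polycyclic \<kappa>)"
    by (rule P.inv_into_iso)
  define f where "f = inv_into (carrier (polycyclic \<kappa>)) h"
  note f = f[folded f_def]
  have bij: "bij_betw f (carrier S) (carrier (polycyclic \<kappa>))" using f by (simp add: iso_def)
  have fz: "f z = polycyclic_zero \<kappa>"
    using is_zero_unique P.zero polycyclic_system.zero[OF S.iso_image[OF f P.monoid_axioms]] by metis
  have exists: "topologically_isomorphic S T (polycyclic \<kappa>) (polycyclic_discrete_topology \<kappa>) \<or>
      topologically_isomorphic S T (polycyclic \<kappa>) (polycyclic_compact_topology \<kappa>)"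
    using dichotomy
  proof
    assume T: "T = discrete_topology (carrier S)"
    have "homeomorphic_map T (polycyclic_discrete_topology \<kappa>) f"
      by (rule homeomorphic_map_bij_betw)
        (use bij in \<open>auto simp: T polycyclic_discrete_topology_def bij_betw_def\<close>)
    then show ?thesis using f unfolding topologically_isomorphic_def by blast
  next
    assume "compact_space T \<and>
      (\<forall>U. openin T U \<longleftrightarrow> U \<subseteq> carrier S \<and> (z \<in> U \<longrightarrow> finite (carrier S - U)))"
    then have T: "openin T U \<longleftrightarrow> U \<subseteq> carrier S \<and> (z \<in> U \<longrightarrow> finite (carrier S - U))" for U
      by blast
    have "homeomorphic_map T (polycyclic_compact_topology \<kappa>) f"
    proof (rule homeomorphic_map_bij_betw)
      show "bij_betw f (topspace T) (topspace (polycyclic_compact_topology \<kappa>))"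
        using bij by (simp add: topspace_polycyclic_compact_topology)
      fix U assume "U \<subseteq> topspace T"
      then have U: "U \<subseteq> carrier S" by simp
      have inj: "inj_on f (carrier S)" and surj: "f ` carrier S = carrier (polycyclic \<kappa>)"
        using bij by (auto simp: bij_betw_def)
      have "polycyclic_zero \<kappa> \<in> f ` U \<longleftrightarrow> z \<in> U"
        unfolding fz[symmetric] by (rule inj_on_image_mem_iff[OF inj _ U]) simp
      moreover have "carrier (polycyclic \<kappa>) - f ` U = f ` (carrier S - U)"
        using inj_on_image_set_diff[OF inj _ U, of "carrier S"] surj by simp
      moreover have "finite (f ` (carrier S - U)) \<longleftrightarrow> finite (carrier S - U)"
        by (rule finite_image_iff) (rule inj_on_subset[OF inj], auto)
      moreover have "f ` U \<subseteq> carrier (polycyclic \<kappa>)" using U surj by blast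
      ultimately show "openin (polycyclic_compact_topology \<kappa>) (f ` U) \<longleftrightarrow> openin T U"
        using U unfolding openin_polycyclic_compact_topology T by simp
    qed
    then show ?thesis using f unfolding topologically_isomorphic_def by blast
  qed
  have unique: "\<mu> =o \<kappa>"
    if \<mu>: "cardinal_ge_2 \<mu>" and g: "g \<in> iso S (polycyclic \<mu>)" for \<mu> :: "'b rel" and g
  proof -
    obtain a b where "a \<in> Field \<mu>" "b \<in> Field \<mu>" "a \<noteq> b"
      using \<mu> by (rule cardinal_ge_2_two_elements)
    then have "|\<Lambda>| =o |Field \<mu>|"
      by (intro card_of_letters_iso_invariant[OF sys polycyclic_system_polycyclic g])
    moreover have "|Field \<mu>| =o \<mu>"
      using \<mu> by (auto simp: cardinal_ge_2_def card_of_Field_ordIso)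
    ultimately have "|\<Lambda>| =o \<mu>" by (rule ordIso_transitive)
    then show ?thesis unfolding \<kappa>_def by (rule ordIso_symmetric)
  qed
  show ?thesis
  proof (intro conjI exI[of _ \<kappa>] \<kappa>2 exists allI impI)
    show "T = discrete_topology (carrier S) \<or> compact_space T"
      using dichotomy by (elim disjE conjE) simp_all
    fix \<mu> :: "'b rel"
    assume \<mu>: "cardinal_ge_2 \<mu> \<and>
      (topologically_isomorphic S T (polycyclic \<mu>) (polycyclic_discrete_topology \<mu>) \<or>
       topologically_isomorphic S T (polycyclic \<mu>) (polycyclic_compact_topology \<mu>))"
    then obtain g where "g \<in> iso S (polycyclic \<mu>)" by (auto simp: topologically_isomorphic_def)
    then show "\<mu> =o \<kappa>" using unique \<mu> by simp
  qed
qed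

end
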